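(* Let $T$ be a bounded linear operator on a complex Hilbert space which is quasiposinormal. If $T$ is $k$-quasiparanormal for some positive integer $k$ and $T^n$ is normal for some positive integer $n$, then $T$ is normal.
   Context: $T$ is quasiposinormal if $\mathcal{N}(T)\subseteq\mathcal{N}(T^* )$ (equivalently $\overline{\mathcal{R}(T)}\subseteq\overline{\mathcal{R}(T^* )}$), where $\mathcal{N}$ and $\mathcal{R}$ denote kernel and range. $T$ is $k$-quasiparanormal if $\|T(T^kx)\|^2\le\|T^2(T^kx)\|\,\|T^kx\|$ for every vector $x$. *)

theory Defs
  imports "HOL-Analysis.Analysis"
begin

class complex_hilbert = banach +
  fixes scaleC :: "complex \<Rightarrow> 'a \<Rightarrow> 'a"
    and cinner :: "'a \<Rightarrow> 'a \<Rightarrow> complex"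
  assumes scaleC_add_right: "scaleC a (x + y) = scaleC a x + scaleC a y"
    and scaleC_add_left: "scaleC (a + b) x = scaleC a x + scaleC b x"
    and scaleC_scaleC: "scaleC a (scaleC b x) = scaleC (a * b) x"
    and scaleC_one: "scaleC 1 x = x"
    and scaleC_of_real: "scaleC (complex_of_real r) x = scaleR r x"
    and cinner_add_left: "cinner (x + y) z = cinner x z + cinner y z"
    and cinner_scaleC_left: "cinner (scaleC a x) y = cnj a * cinner x y"
    and cinner_commute: "cinner y x = cnj (cinner x y)"
    and norm_eq_sqrt_cinner: "norm x = sqrt (Re (cinner x x))"

definition bounded_clinear :: "('a::complex_hilbert \<Rightarrow> 'a) \<Rightarrow> bool" where
  "bounded_clinear T \<longleftrightarrow> bounded_linear T \<and> (\<forall>c x. T (scaleC c x) = scaleC c (T x))"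

definition is_adjoint :: "('a::complex_hilbert \<Rightarrow> 'a) \<Rightarrow> ('a \<Rightarrow> 'a) \<Rightarrow> bool" where
  "is_adjoint T S \<longleftrightarrow> (\<forall>x y. cinner (T x) y = cinner x (S y))"

definition ker :: "('a::complex_hilbert \<Rightarrow> 'a) \<Rightarrow> 'a set" where
  "ker T = {x. T x = 0}"

text \<open>Quasiposinormal: N(T) \<subseteq> N(T*), where S = T*.\<close>
definition quasiposinormal :: "('a::complex_hilbert \<Rightarrow> 'a) \<Rightarrow> ('a \<Rightarrow> 'a) \<Rightarrow> bool" where
  "quasiposinormal T S \<longleftrightarrow> ker T \<subseteq> ker S"

definition k_quasiparanormal :: "nat \<Rightarrow> ('a::complex_hilbert \<Rightarrow> 'a) \<Rightarrow> bool" where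
  "k_quasiparanormal k T \<longleftrightarrow>
     (\<forall>x. norm (T ((T ^^ k) x)) ^ 2 \<le> norm ((T ^^ 2) ((T ^^ k) x)) * norm ((T ^^ k) x))"

text \<open>Normality of an operator A whose adjoint is B: A A* = A* A.\<close>
definition normal_op :: "('a::complex_hilbert \<Rightarrow> 'a) \<Rightarrow> ('a \<Rightarrow> 'a) \<Rightarrow> bool" where
  "normal_op A B \<longleftrightarrow> A \<circ> B = B \<circ> A"

end

theory Submission
  imports Defs
begin

text \<open>
  Write \<open>N = T ^^ n\<close>. The kernel condition and normality of \<open>N\<close> give
  \<open>ker T = ker N = R(T\<^sup>p)\<^sup>\<bottom>\<close> for every multiple \<open>p\<close> of \<open>n\<close>, so \<open>k\<close>-quasiparanormality passes
  to the closure of \<open>R(T\<^sup>p)\<close> and then to the whole space: \<open>T\<close> is paranormal.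

  For \<open>r > 0\<close> let \<open>E\<^sub>r\<close> be the set of vectors with \<open>\<parallel>N\<^sup>j x\<parallel> = O(r\<^sup>j)\<close>. This is the spectral subspace of
  \<open>|N|\<close> for \<open>[0,r]\<close>, but its definition makes it evident (without Fuglede's theorem) that it is
  invariant under everything commuting with \<open>N\<close> or with \<open>N\<^sup>*\<close>; in particular it reduces \<open>T\<close>.
  Paranormality makes \<open>j \<mapsto> \<parallel>T\<^sup>j x\<parallel>\<close> log-convex, hence \<open>\<parallel>T x\<parallel> \<le> \<rho> \<parallel>x\<parallel>\<close> on the space \<open>E\<^sub>r\<close> with
  \<open>r = \<rho>\<^sup>n\<close>, whereas \<open>\<parallel>N x\<parallel> \<ge> r \<parallel>x\<parallel>\<close> on its orthogonal complement. On thin slices both \<open>T\<close> and \<open>T\<^sup>*\<close>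
  are therefore nearly multiples of isometries with the same factor, and summing over the
  slices gives \<open>\<parallel>T x\<parallel> = \<parallel>T\<^sup>* x\<parallel>\<close>.
\<close>

section \<open>Real inner product and orthogonal projection\<close>

text \<open>Nothing in the argument uses the complex structure, so it is carried out with the real part of
  the inner product; adjoints and orthogonal complements of complex subspaces are the same for both.\<close>

definition rip :: "'a::complex_hilbert \<Rightarrow> 'a \<Rightarrow> real" where
  "rip x y = Re (cinner x y)"

definition radjoint :: "('a::complex_hilbert \<Rightarrow> 'a) \<Rightarrow> ('a \<Rightarrow> 'a) \<Rightarrow> bool" where
  "radjoint T S \<longleftrightarrow> (\<forall>x y. rip (T x) y = rip x (S y))"

lemma rip_commute: "rip x y = rip y x"
  unfolding rip_def using cinner_commute[of x y] by simp

lemma rip_add_left: "rip (x + y) z = rip x z + rip y z"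
  by (simp add: rip_def cinner_add_left)

lemma rip_scaleR_left: "rip (r *\<^sub>R x) y = r * rip x y"
  by (simp add: rip_def cinner_scaleC_left flip: scaleC_of_real)

lemma rip_self: "rip x x = (norm x)\<^sup>2"
proof -
  have n: "norm x = sqrt (rip x x)"
    by (simp add: rip_def norm_eq_sqrt_cinner)
  \<comment> \<open>\<open>sqrt\<close> is odd on the reals, so a nonnegative root forces a
    nonnegative argument.\<close>
  then have "rip x x \<ge> 0"
    by (metis norm_ge_zero real_sqrt_ge_0_iff)
  with n show ?thesis by simp
qed

lemma norm_add_sq: "(norm (x + y))\<^sup>2 = (norm x)\<^sup>2 + 2 * rip x y + (norm y)\<^sup>2"
proof -
  have "rip (x + y) (x + y) = rip x x + 2 * rip x y + rip y y"
    by (simp add: rip_add_left rip_commute[of x "x + y"]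
      rip_commute[of y "x + y"] rip_commute[of y x])
  then show ?thesis by (simp add: rip_self)
qed

text \<open>Cauchy-Schwarz. The norm already obeys the triangle inequality, and squaring that is
  enough.\<close>

lemma rip_le_norm: "rip x y \<le> norm x * norm y"
proof -
  have "(norm (x + y))\<^sup>2 \<le> (norm x + norm y)\<^sup>2"
    by (intro power_mono norm_triangle_ineq norm_ge_zero)
  then show ?thesis
    by (simp add: norm_add_sq power2_sum)
qed

lemma abs_rip_le_norm: "\<bar>rip x y\<bar> \<le> norm x * norm y"
  using rip_le_norm[of x y] rip_le_norm[of "- x" y] rip_scaleR_left[of "-1" x y]
  by simp

interpretation rip: bounded_bilinear rip
proof
  fix a a' b b' :: "'a::complex_hilbert" and r :: real
  show "rip (a + a') b = rip a b + rip a' b" by (rule rip_add_left)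
  show "rip a (b + b') = rip a b + rip a b'"
    by (simp add: rip_add_left rip_commute[of a])
  show "rip (r *\<^sub>R a) b = r *\<^sub>R rip a b" by (simp add: rip_scaleR_left)
  show "rip a (r *\<^sub>R b) = r *\<^sub>R rip a b"
    by (simp add: rip_scaleR_left rip_commute[of a])
  show "\<exists>K. \<forall>a b::'a. norm (rip a b) \<le> norm a * norm b * K"
    by (rule exI[of _ 1]) (simp add: abs_rip_le_norm)
qed

lemma norm_diff_sq: "(norm (x - y))\<^sup>2 = (norm x)\<^sup>2 - 2 * rip x y + (norm y)\<^sup>2"
  using norm_add_sq[of x "- y"] by (simp add: rip.minus_right)

lemma rip_eq_zero_all: "(\<And>y. rip x y = 0) \<Longrightarrow> x = 0"
  using rip_self[of x] by simp

text \<open>A minimizing sequence for the distance to \<open>K\<close> is Cauchy by the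
  parallelogram law; its limit \<open>u\<close> is a nearest point, and nearness in every direction
  \<open>v\<close> means orthogonality.\<close>

lemma orthogonal_projection_exists:
  fixes x :: "'a::complex_hilbert"
  assumes cl: "closed K" and sub: "subspace K"
  obtains u where "u \<in> K" "\<And>v. v \<in> K \<Longrightarrow> rip (x - u) v = 0"
proof -
  define d where "d = infdist x K"
  have K0: "K \<noteq> {}" using subspace_0[OF sub] by blast
  have d0: "d \<ge> 0" by (simp add: d_def infdist_nonneg)
  have dle: "d \<le> norm (x - y)" if "y \<in> K" for y
    unfolding d_def by (metis dist_norm infdist_le that)
  have "\<exists>y\<in>K. norm (x - y) < d + 1 / Suc j" for j :: nat
  proof -
    have "\<exists>y\<in>K. dist x y < d + 1 / Suc j"
    proof (rule ccontr)
      assume "\<not> ?thesis"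
      then have "d + 1 / Suc j \<le> (INF y\<in>K. dist x y)"
        by (intro cINF_greatest[OF K0]) force
      then show False by (simp add: d_def infdist_notempty[OF K0])
    qed
    then show ?thesis by (simp add: dist_norm)
  qed
  then obtain y where yK: "\<And>j. y j \<in> K" and yd: "\<And>j. norm (x - y j) < d + 1 / Suc j"
    by metis
  have par: "(norm (y i - y j))\<^sup>2 \<le> 2 * (norm (x - y i))\<^sup>2 + 2 * (norm (x - y j))\<^sup>2 - 4 * d\<^sup>2" for i j
  proof -
    \<comment> \<open>The midpoint lies in \<open>K\<close>, so its distance from \<open>x\<close>
      is at least \<open>d\<close>; this bounds the sum term of the parallelogram identity from
      below.\<close>
    have mid: "(1/2) *\<^sub>R (y i + y j) \<in> K"
      by (intro subspace_scale[OF sub] subspace_add[OF sub] yK)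
    have "(x - y i) + (x - y j) = 2 *\<^sub>R (x - (1/2) *\<^sub>R (y i + y j))"
      by (simp add: algebra_simps scaleR_2)
    then have "norm ((x - y i) + (x - y j)) \<ge> 2 * d"
      using dle[OF mid] by simp
    then have "(norm ((x - y i) + (x - y j)))\<^sup>2 \<ge> (2 * d)\<^sup>2"
      using d0 by (intro power_mono) auto
    moreover have "(norm ((x - y i) - (x - y j)))\<^sup>2 = (norm (y i - y j))\<^sup>2"
      by (simp add: norm_minus_commute)
    ultimately show ?thesis
      using norm_add_sq[of "x - y i" "x - y j"] norm_diff_sq[of "x - y i" "x - y j"]
      by (simp add: power_mult_distrib)
  qed
  have lim: "(\<lambda>j. (norm (x - y j))\<^sup>2) \<longlonglongrightarrow> d\<^sup>2"
  proof (rule tendsto_power, rule tendsto_sandwich)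
    show "\<forall>\<^sub>F j in sequentially. d \<le> norm (x - y j)" using dle[OF yK] by simp
    show "\<forall>\<^sub>F j in sequentially. norm (x - y j) \<le> d + 1 / Suc j"
      using yd by (simp add: less_imp_le)
    have "(\<lambda>j. d + 1 / real (Suc j)) \<longlonglongrightarrow> d + 0"
      by (intro tendsto_add tendsto_const LIMSEQ_Suc[OF lim_1_over_n])
    then show "(\<lambda>j. d + 1 / real (Suc j)) \<longlonglongrightarrow> d" by simp
  qed simp
  have "Cauchy y"
  proof (rule metric_CauchyI)
    fix e :: real assume e: "e > 0"
    then have "\<forall>\<^sub>F j in sequentially. (norm (x - y j))\<^sup>2 < d\<^sup>2 + e\<^sup>2 / 4"
      by (intro order_tendstoD(2)[OF lim]) simp
    then obtain M where M: "\<And>j. j \<ge> M \<Longrightarrow> (norm (x - y j))\<^sup>2 < d\<^sup>2 + e\<^sup>2 / 4"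
      unfolding eventually_sequentially by blast
    have "dist (y i) (y j) < e" if "i \<ge> M" "j \<ge> M" for i j
    proof -
      have "(norm (y i - y j))\<^sup>2 < e\<^sup>2"
        using par[of i j] M[OF that(1)] M[OF that(2)] by linarith
      then show ?thesis using e by (simp add: dist_norm power_less_imp_less_base)
    qed
    then show "\<exists>M. \<forall>i\<ge>M. \<forall>j\<ge>M. dist (y i) (y j) < e" by blast
  qed
  then obtain u where u: "y \<longlonglongrightarrow> u"
    using convergent_def Cauchy_convergent_iff by blast
  have uK: "u \<in> K"
    using closed_sequentially[OF cl _ u] yK by blast
  have "(\<lambda>j. (norm (x - y j))\<^sup>2) \<longlonglongrightarrow> (norm (x - u))\<^sup>2"
    by (intro tendsto_intros u)
  then have nu: "(norm (x - u))\<^sup>2 = d\<^sup>2"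
    using lim LIMSEQ_unique by blast
  have "rip (x - u) v = 0" if v: "v \<in> K" for v
  proof (cases "v = 0")
    case False
    \<comment> \<open>The minimizer of the quadratic \<open>norm (x - u - t *\<^sub>R v)\<close>
      squared in \<open>t\<close>.\<close>
    define t where "t = rip (x - u) v / (norm v)\<^sup>2"
    have v2: "(norm v)\<^sup>2 > 0" using False by simp
    have "u + t *\<^sub>R v \<in> K"
      by (intro subspace_add[OF sub] subspace_scale[OF sub] uK v)
    from dle[OF this] have "d\<^sup>2 \<le> (norm (x - (u + t *\<^sub>R v)))\<^sup>2"
      using d0 by (intro power_mono)
    also have "\<dots> = (norm ((x - u) - t *\<^sub>R v))\<^sup>2"
      by (simp add: diff_diff_eq)
    also have "\<dots> = d\<^sup>2 - 2 * (t * rip (x - u) v) + t\<^sup>2 * (norm v)\<^sup>2"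
      unfolding norm_diff_sq[of "x - u" "t *\<^sub>R v"] nu
      by (simp add: rip.scaleR_right power_mult_distrib)
    also have "\<dots> = d\<^sup>2 - (rip (x - u) v)\<^sup>2 / (norm v)\<^sup>2"
      using v2 by (simp add: t_def power2_eq_square field_simps)
    finally have "(rip (x - u) v)\<^sup>2 / (norm v)\<^sup>2 \<le> 0" by simp
    then show ?thesis using v2 by (simp add: divide_le_0_iff)
  qed (simp add: rip.zero_right)
  with uK that show thesis by blast
qed

section \<open>Bounded operators: powers, adjoints, positivity\<close>

lemma bounded_linear_funpow:
  assumes "bounded_linear (A :: 'a::real_normed_vector \<Rightarrow> 'a)"
  shows "bounded_linear (A ^^ j)"
proof (induction j)
  case 0
  show ?case by (simp add: id_def bounded_linear_ident)
next
  case (Suc j)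
  then show ?case using bounded_linear_compose[OF assms Suc] by (simp add: comp_def)
qed

lemma radjoint_funpow:
  assumes "radjoint T S" shows "radjoint (T ^^ j) (S ^^ j)"
proof (induction j)
  case (Suc j)
  show ?case
    unfolding radjoint_def
  proof (intro allI)
    fix x y
    have "rip ((T ^^ Suc j) x) y = rip ((T ^^ j) x) (S y)"
      using assms by (simp add: radjoint_def)
    also have "\<dots> = rip x ((S ^^ j) (S y))"
      using Suc by (simp add: radjoint_def)
    finally show "rip ((T ^^ Suc j) x) y = rip x ((S ^^ Suc j) y)"
      by (simp add: funpow_swap1)
  qed
qed (simp add: radjoint_def)

lemma radjointD: "radjoint T S \<Longrightarrow> rip (T x) y = rip x (S y)"
  by (simp add: radjoint_def)

lemma radjoint_sym: "radjoint T S \<Longrightarrow> radjoint S T"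
  by (simp add: radjoint_def rip_commute[of "S _"] rip_commute[of _ "T _"])

text \<open>Testing against all vectors moves linearity from \<open>T\<close> to \<open>S\<close>;
  the bound comes from \<open>rip (S x) (S x) = rip (T (S x)) x\<close>.\<close>

lemma radjoint_bounded_linear:
  assumes T: "bounded_linear T" and adj: "radjoint T S"
  shows "bounded_linear S"
proof -
  obtain K where K: "\<And>x. norm (T x) \<le> norm x * K"
    using bounded_linear.bounded[OF T] by blast
  have sw: "rip (S x) y = rip x (T y)" for x y using radjointD[OF radjoint_sym[OF adj]] .
  show ?thesis
  proof (rule bounded_linear_intro[where K = K])
    show "S (x + y) = S x + S y" for x y
    proof -
      have "S (x + y) - (S x + S y) = 0"
        by (rule rip_eq_zero_all) (simp add: rip.diff_left rip.add_left sw)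
      then show ?thesis by simp
    qed
    show "S (r *\<^sub>R x) = r *\<^sub>R S x" for r x
    proof -
      have "S (r *\<^sub>R x) - r *\<^sub>R S x = 0"
        by (rule rip_eq_zero_all) (simp add: rip.diff_left rip.scaleR_left sw)
      then show ?thesis by simp
    qed
    show "norm (S x) \<le> norm x * K" for x
    proof (cases "S x = 0")
      case True
      have "0 \<le> norm x * K" using K[of x] norm_ge_zero order_trans by blast
      with True show ?thesis by simp
    next
      case False
      have "norm (S x) * norm (S x) = rip (T (S x)) x"
        using radjointD[OF adj, of "S x" x] rip_self[of "S x"] by (simp add: power2_eq_square)
      also have "\<dots> \<le> norm (T (S x)) * norm x" by (rule rip_le_norm)
      also have "\<dots> \<le> norm (S x) * K * norm x"
        by (intro mult_right_mono K) simp
      finally have "norm (S x) * norm (S x) \<le> norm (S x) * (norm x * K)"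
        by (simp add: mult_ac)
      then show ?thesis using False by simp
    qed
  qed
qed

text \<open>Lax-Milgram: coercivity bounds \<open>Q\<close> below, so its range is closed, and a
  vector \<open>z\<close> orthogonal to the range is orthogonal to \<open>Q z\<close>, hence
  zero.\<close>

lemma surj_of_coercive:
  fixes Q :: "'a::complex_hilbert \<Rightarrow> 'a"
  assumes Q: "bounded_linear Q" and pos: "\<And>x. rip (Q x) x \<ge> (norm x)\<^sup>2"
  shows "\<exists>w. Q w = x"
proof -
  have lin: "linear Q" using Q by (rule bounded_linear.linear)
  have low: "norm x \<le> norm (Q x)" for x
  proof (cases "x = 0")
    case False
    have "norm x * norm x \<le> norm (Q x) * norm x"
      using pos[of x] rip_le_norm[of "Q x" x] by (simp add: power2_eq_square)
    then show ?thesis using False by simp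
  qed simp
  have sub: "subspace (range Q)"
    by (rule linear_subspace_image[OF lin subspace_UNIV])
  have "complete (Q ` UNIV)"
    by (rule complete_isometric_image[OF zero_less_one subspace_UNIV Q])
       (simp_all add: low complete_UNIV)
  then have cl: "closed (range Q)" by (rule complete_imp_closed)
  obtain u where u: "u \<in> range Q" "\<And>v. v \<in> range Q \<Longrightarrow> rip (x - u) v = 0"
    using orthogonal_projection_exists[OF cl sub] by blast
  have "(norm (x - u))\<^sup>2 \<le> 0"
    using pos[of "x - u"] u(2)[of "Q (x - u)"] by (simp add: rip_commute)
  then have "x = u" by simp
  with u(1) show ?thesis by blast
qed

text \<open>By symmetry only \<open>i + j\<close> matters. Splitting it as evenly as possible leaves
  a squared norm or a value \<open>rip (A y) y\<close> with \<open>y = (A ^^ p) x\<close>.\<close>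

lemma positive_funpow:
  assumes sym: "radjoint A A" and pos: "\<And>x. rip (A x) x \<ge> 0"
  shows "rip ((A ^^ i) x) ((A ^^ j) x) \<ge> 0"
proof -
  have shift: "rip ((A ^^ i) x) ((A ^^ j) x) = rip ((A ^^ (j + i)) x) x" for i j
    using radjointD[OF radjoint_funpow[OF sym], of j "(A ^^ i) x" x]
    by (simp add: funpow_add)
  define p where "p = (j + i) div 2"
  have "j + i = p + p \<or> j + i = p + Suc p" unfolding p_def by presburger
  then have "rip ((A ^^ i) x) ((A ^^ j) x) = rip ((A ^^ p) x) ((A ^^ p) x) \<or>
    rip ((A ^^ i) x) ((A ^^ j) x) = rip ((A ^^ Suc p) x) ((A ^^ p) x)"
    unfolding shift[of i j] shift[of p p] shift[of "Suc p" p] by metis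
  then show ?thesis using pos by (auto simp: rip_self)
qed

lemma funpow_commute:
  assumes "\<And>x. f (g x) = g (f x)"
  shows "(f ^^ i) ((g ^^ j) x) = (g ^^ j) ((f ^^ i) x)"
proof -
  have "f ((g ^^ j) x) = (g ^^ j) (f x)" for x
    by (induction j) (simp_all add: assms)
  then show ?thesis by (induction i) simp_all
qed

text \<open>With \<open>w\<^sub>j = (1 + A + \<dots> + A\<^sup>j)\<^sup>-\<^sup>1 x\<close>, the inverses decrease to \<open>max 0 (1 - A)\<close>. The
  limit of \<open>w\<^sub>j\<close> has a bounded orbit, so it is orthogonal to \<open>x\<close> and must vanish, and \<open>A x - x = A\<^sup>j\<^sup>+\<^sup>1 w\<^sub>j - w\<^sub>j\<close>.\<close>

lemma positive_lower_bound:
  fixes A :: "'a::complex_hilbert \<Rightarrow> 'a"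
  assumes A: "bounded_linear A" and sym: "radjoint A A" and pos: "\<And>z. rip (A z) z \<ge> 0"
    and orth: "\<And>z C. (\<And>j. norm ((A ^^ j) z) \<le> C) \<Longrightarrow> rip x z = 0"
  shows "(norm x)\<^sup>2 \<le> rip (A x) x"
proof -
  define Q where "Q = (\<lambda>j z. \<Sum>i\<le>j. (A ^^ i) z)"
  note ppos = positive_funpow[OF sym pos]
  have blp: "bounded_linear (A ^^ i)" for i by (rule bounded_linear_funpow[OF A])
  have blQ: "bounded_linear (Q j)" for j
    unfolding Q_def by (intro bounded_linear_sum blp)
  \<comment> \<open>All cross terms between powers are nonnegative, so no cancellation occurs. The
    case \<open>i = 0\<close> makes \<open>Q j\<close> injective.\<close>
  have term_le: "norm ((A ^^ i) z) \<le> norm (Q j z)" if "i \<le> j" for i j z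
  proof -
    define R where "R = (\<Sum>m\<in>{..j} - {i}. (A ^^ m) z)"
    have Q: "Q j z = (A ^^ i) z + R"
      unfolding Q_def R_def using that by (intro sum.remove) auto
    have "rip ((A ^^ i) z) R \<ge> 0"
      unfolding R_def rip.sum_right by (intro sum_nonneg ppos)
    then have "(norm ((A ^^ i) z))\<^sup>2 \<le> (norm (Q j z))\<^sup>2"
      unfolding Q norm_add_sq by simp
    then show ?thesis by (rule power2_le_imp_le) simp
  qed
  have coercive: "(norm z)\<^sup>2 \<le> rip (Q j z) z" for j z
  proof -
    have "(\<Sum>i\<in>{0}. rip ((A ^^ i) z) z) \<le> (\<Sum>i\<le>j. rip ((A ^^ i) z) z)"
      using ppos[of _ z 0] by (intro sum_mono2) auto
    then show ?thesis by (simp add: Q_def rip.sum_left rip_self)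
  qed
  have surj: "\<exists>w. Q j w = z" for j z
    using surj_of_coercive[OF blQ coercive] .
  define w where "w = (\<lambda>j. SOME w. Q j w = x)"
  have w: "Q j (w j) = x" for j
    unfolding w_def using surj[of j x] by (rule someI_ex)
  \<comment> \<open>It suffices that \<open>rip (w l) (w j - w l)\<close> is nonnegative. With
    \<open>w l = Q j u\<close> the difference is \<open>R u\<close>, where \<open>R\<close> collects
    the powers from \<open>j + 1\<close> to \<open>l\<close>, so only pairings of powers at
    \<open>u\<close> occur.\<close>
  have decr: "(norm (w j - w l))\<^sup>2 \<le> (norm (w j))\<^sup>2 - (norm (w l))\<^sup>2" if "j \<le> l" for j l
  proof -
    interpret Qj: bounded_linear "Q j" by (rule blQ)
    define R where "R = (\<lambda>z. \<Sum>i\<in>{j<..l}. (A ^^ i) z)"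
    have split: "Q l z = Q j z + R z" for z
    proof -
      have *: "{..l} = {..j} \<union> {j<..l}" using that by auto
      show ?thesis unfolding Q_def R_def * by (rule sum.union_disjoint) auto
    qed
    obtain u where u: "Q j u = w l" using surj by blast
    have QA: "Q j ((A ^^ i) u) = (A ^^ i) (Q j u)" for i
    proof -
      have "(A ^^ m) ((A ^^ i) u) = (A ^^ i) ((A ^^ m) u)" for m
        by (rule funpow_commute[of A A]) (rule refl)
      then show ?thesis
        by (simp add: Q_def linear_sum[OF bounded_linear.linear[OF blp]])
    qed
    have "Q j (w j - w l) = Q l (w l) - Q j (w l)"
      by (simp add: Qj.diff w)
    also have "\<dots> = R (Q j u)" by (simp add: split u)
    also have "\<dots> = Q j (R u)" by (simp add: R_def Qj.sum QA)
    finally have "Q j (w j - w l - R u) = 0" by (simp add: Qj.diff)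
    then have eq: "w j - w l = R u"
      using term_le[of 0 j "w j - w l - R u"] by simp
    have "rip (Q j u) (R u) \<ge> 0"
      unfolding Q_def R_def rip.sum_left rip.sum_right
      by (intro sum_nonneg ppos)
    then have "rip (w l) (w j - w l) \<ge> 0" by (simp add: eq u)
    then show ?thesis using norm_add_sq[of "w l" "w j - w l"] by simp
  qed
  have "decseq (\<lambda>j. (norm (w j))\<^sup>2)"
    unfolding decseq_def
  proof (intro allI impI)
    fix m n :: nat assume "m \<le> n"
    then show "(norm (w n))\<^sup>2 \<le> (norm (w m))\<^sup>2"
      using decr[of m n] zero_le_power2[of "norm (w m - w n)"] by linarith
  qed
  then obtain L where "(\<lambda>j. (norm (w j))\<^sup>2) \<longlonglongrightarrow> L"
    using decseq_convergent[of "\<lambda>j. (norm (w j))\<^sup>2" 0] by auto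
  then have Ca: "Cauchy (\<lambda>j. (norm (w j))\<^sup>2)"
    by (rule LIMSEQ_imp_Cauchy)
  have "Cauchy w"
  proof (rule metric_CauchyI)
    fix e :: real assume e: "e > 0"
    then obtain M where M: "\<And>i j. i \<ge> M \<Longrightarrow> j \<ge> M \<Longrightarrow>
        \<bar>(norm (w i))\<^sup>2 - (norm (w j))\<^sup>2\<bar> < e\<^sup>2"
      using metric_CauchyD[OF Ca, of "e\<^sup>2"] by (auto simp: dist_real_def)
    have main: "dist (w i) (w j) < e" if "i \<ge> M" "i \<le> j" for i j
    proof -
      have "(norm (w i - w j))\<^sup>2 < e\<^sup>2"
        using decr[OF that(2)] M[of i j] that by simp
      then show ?thesis using e by (simp add: dist_norm power_less_imp_less_base)
    qed
    have "dist (w i) (w j) < e" if "i \<ge> M" "j \<ge> M" for i j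
      using main[of i j] main[of j i] that by (cases "i \<le> j") (auto simp: dist_commute)
    then show "\<exists>M. \<forall>i\<ge>M. \<forall>j\<ge>M. dist (w i) (w j) < e" by blast
  qed
  then obtain g where g: "w \<longlonglongrightarrow> g"
    using convergent_def Cauchy_convergent_iff by blast
  \<comment> \<open>For \<open>j \<ge> i\<close> the vector \<open>(A ^^ i) (w j)\<close> is one
    summand of \<open>Q j (w j) = x\<close>.\<close>
  have "norm ((A ^^ i) g) \<le> norm x" for i
  proof (rule LIMSEQ_le_const2)
    show "(\<lambda>j. norm ((A ^^ i) (w j))) \<longlonglongrightarrow> norm ((A ^^ i) g)"
      by (intro tendsto_norm bounded_linear.tendsto[OF blp] g)
    show "\<exists>N. \<forall>j\<ge>N. norm ((A ^^ i) (w j)) \<le> norm x"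
      using term_le[of i _ "w _"] w by metis
  qed
  then have xg: "rip x g = 0" by (rule orth)
  have limx: "(\<lambda>j. rip x (w j)) \<longlonglongrightarrow> 0"
    using rip.tendsto[OF tendsto_const g, of x] xg by simp
  have "(norm g)\<^sup>2 \<le> 0"
  proof (rule LIMSEQ_le[OF _ limx])
    show "(\<lambda>j. (norm (w j))\<^sup>2) \<longlonglongrightarrow> (norm g)\<^sup>2"
      by (intro tendsto_intros g)
    show "\<exists>N. \<forall>j\<ge>N. (norm (w j))\<^sup>2 \<le> rip x (w j)"
      using coercive[of "w _" _] w by metis
  qed
  have tele: "A (Q j z) - Q j z = (A ^^ Suc j) z - z" for j z
  proof (induction j)
    case (Suc j)
    have "Q (Suc j) z = Q j z + (A ^^ Suc j) z" by (simp add: Q_def)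
    then show ?case
      using Suc by (simp add: linear_add[OF bounded_linear.linear[OF A]] algebra_simps)
  qed (simp add: Q_def)
  \<comment> \<open>Telescoping, and replacing one \<open>x\<close> by \<open>Q j (w j)\<close>,
    leaves a nonnegative pairing minus \<open>rip x (w j)\<close>, which tends to zero.\<close>
  have low: "- rip x (w j) \<le> rip (A x - x) x" for j
  proof -
    have "A x - x = (A ^^ Suc j) (w j) - w j" using tele[of j "w j"] w by simp
    then have "rip (A x - x) x = rip ((A ^^ Suc j) (w j)) (Q j (w j)) - rip x (w j)"
      using w[of j] rip_commute[of x "w j"] by (simp add: rip.diff_left)
    moreover have "rip ((A ^^ Suc j) (w j)) (Q j (w j)) \<ge> 0"
      unfolding Q_def rip.sum_right by (intro sum_nonneg ppos)
    ultimately show ?thesis by linarith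
  qed
  have "- 0 \<le> rip (A x - x) x"
    by (rule LIMSEQ_le_const2[OF tendsto_minus[OF limx]]) (use low in blast)
  then show ?thesis by (simp add: rip.diff_left rip_self)
qed

section \<open>Growth subspaces\<close>

definition paranormal :: "('a::complex_hilbert \<Rightarrow> 'a) \<Rightarrow> bool" where
  "paranormal T \<longleftrightarrow> (\<forall>x. (norm (T x))\<^sup>2 \<le> norm (T (T x)) * norm x)"

definition growth_space :: "('a::complex_hilbert \<Rightarrow> 'a) \<Rightarrow> real \<Rightarrow> 'a set" where
  "growth_space N r = {x. \<exists>C. \<forall>j. norm ((N ^^ j) x) \<le> C * r ^ j}"

lemma growth_spaceI: "(\<And>j. norm ((N ^^ j) x) \<le> C * r ^ j) \<Longrightarrow> x \<in> growth_space N r"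
  by (auto simp: growth_space_def)

text \<open>Paranormality makes the ratios of successive norms of \<open>(T ^^ j) x\<close>
  nondecreasing. A first ratio \<open>q > r\<close> would force growth at least
  \<open>q ^ j\<close>, which eventually exceeds \<open>C * r ^ j\<close>.\<close>

lemma paranormal_growth_step:
  assumes par: "paranormal T" and r: "r > 0" and x: "x \<in> growth_space T r"
  shows "norm (T x) \<le> r * norm x"
proof (rule ccontr)
  obtain C where C: "\<And>j. norm ((T ^^ j) x) \<le> C * r ^ j"
    using x by (auto simp: growth_space_def)
  assume "\<not> ?thesis"
  then have gt: "norm (T x) > r * norm x" by simp
  have "norm x > 0"
  proof (rule ccontr)
    assume "\<not> norm x > 0"
    then have "norm x = 0" by simp
    moreover have "(norm (T x))\<^sup>2 \<le> norm (T (T x)) * norm x" using par by (simp add: paranormal_def)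
    ultimately show False using gt by simp
  qed
  define q where "q = norm (T x) / norm x"
  have qr: "q > r" using gt \<open>norm x > 0\<close> by (simp add: q_def pos_less_divide_eq)
  then have q0: "q > 0" using r by simp
  \<comment> \<open>Positivity is carried along so that the ratio can be cancelled in the next
    step.\<close>
  have step: "norm ((T ^^ j) x) > 0 \<and> norm ((T ^^ Suc j) x) \<ge> q * norm ((T ^^ j) x)" for j
  proof (induction j)
    case 0
    then show ?case using \<open>norm x > 0\<close> by (simp add: q_def)
  next
    case (Suc j)
    let ?a = "norm ((T ^^ j) x)" and ?b = "norm ((T ^^ Suc j) x)" and ?c = "norm ((T ^^ Suc (Suc j)) x)"
    have a: "?a > 0" and ba: "?b \<ge> q * ?a" using Suc by blast+
    have b: "?b > 0" using a ba q0 mult_pos_pos[OF q0 a] by linarith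
    have "?b * ?b \<le> ?c * ?a"
      using par by (simp add: paranormal_def power2_eq_square)
    moreover have "(q * ?a) * ?b \<le> ?b * ?b" using ba b by (intro mult_right_mono) auto
    ultimately have "(q * ?b) * ?a \<le> ?c * ?a" by (simp add: mult_ac)
    then have "q * ?b \<le> ?c" using a by (simp only: mult_le_cancel_right_pos)
    with b show ?case by blast
  qed
  have "q ^ j * norm x \<le> norm ((T ^^ j) x)" for j
  proof (induction j)
    case (Suc j)
    have "q ^ Suc j * norm x \<le> q * norm ((T ^^ j) x)"
      using Suc q0 by simp
    then show ?case using step[of j] by linarith
  qed simp
  then have "(q / r) ^ j * norm x \<le> C" for j
    using order_trans[OF _ C[of j]] r by (simp add: power_divide field_simps)
  then have le: "(q / r) ^ j \<le> C / norm x" for j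
    using \<open>norm x > 0\<close> by (simp add: field_simps)
  have "1 < q / r" using qr r by simp
  then obtain j where "C / norm x < (q / r) ^ j" using real_arch_pow by blast
  with le[of j] show False by simp
qed

lemma growth_space_commuting:
  assumes B: "bounded_linear B" and comm: "\<And>x. B (N x) = N (B x)"
    and x: "x \<in> growth_space N r"
  shows "B x \<in> growth_space N r"
proof -
  obtain C where C: "\<And>j. norm ((N ^^ j) x) \<le> C * r ^ j"
    using x by (auto simp: growth_space_def)
  obtain K where K: "K > 0" "\<And>x. norm (B x) \<le> norm x * K"
    using bounded_linear.pos_bounded[OF B] by blast
  have c: "(N ^^ j) (B x) = B ((N ^^ j) x)" for j
    by (induction j) (simp_all add: comm)
  show ?thesis
  proof (rule growth_spaceI)
    fix j
    have "norm ((N ^^ j) (B x)) \<le> norm ((N ^^ j) x) * K" by (simp add: c K)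
    also have "\<dots> \<le> C * r ^ j * K" by (intro mult_right_mono C) (use K in simp)
    finally show "norm ((N ^^ j) (B x)) \<le> (C * K) * r ^ j" by (simp add: mult_ac)
  qed
qed

text \<open>The iterates of \<open>x\<close> stay in the space, so the one-step bound repeats and
  \<open>C\<close> may be taken to be \<open>norm x\<close>. The space thereby becomes an
  intersection of closed sets.\<close>

lemma growth_space_paranormal:
  assumes N: "bounded_linear N" and par: "paranormal N" and r: "r > 0"
  shows "growth_space N r = {x. \<forall>j. norm ((N ^^ j) x) \<le> r ^ j * norm x}"
proof (intro set_eqI iffI CollectI allI)
  fix x j assume "x \<in> growth_space N r"
  then show "norm ((N ^^ j) x) \<le> r ^ j * norm x"
  proof (induction j arbitrary: x)
    case (Suc j)
    have "norm ((N ^^ Suc j) x) = norm ((N ^^ j) (N x))" by (simp add: funpow_swap1)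
    also have "\<dots> \<le> r ^ j * norm (N x)"
      by (intro Suc.IH growth_space_commuting[OF N _ Suc.prems]) simp
    also have "\<dots> \<le> r ^ j * (r * norm x)"
      using r by (intro mult_left_mono paranormal_growth_step[OF par r Suc.prems]) auto
    finally show ?case by (simp add: mult_ac)
  qed simp
next
  fix x assume "x \<in> {x. \<forall>j. norm ((N ^^ j) x) \<le> r ^ j * norm x}"
  then show "x \<in> growth_space N r"
    by (intro growth_spaceI[where C = "norm x"]) (simp add: mult.commute)
qed

lemma subspace_growth_space:
  assumes N: "bounded_linear N" and r: "r > 0"
  shows "subspace (growth_space N r)"
proof (rule subspaceI)
  note lin = bounded_linear.linear[OF bounded_linear_funpow[OF N]]
  show "0 \<in> growth_space N r"
    by (rule growth_spaceI[where C = 0]) (simp add: linear_0[OF lin])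
  fix x assume "x \<in> growth_space N r"
  then obtain C where C: "\<And>j. norm ((N ^^ j) x) \<le> C * r ^ j"
    by (auto simp: growth_space_def)
  show "c *\<^sub>R x \<in> growth_space N r" for c
    by (rule growth_spaceI[where C = "\<bar>c\<bar> * C"])
       (simp add: linear_scale[OF lin] mult.assoc mult_left_mono[OF C])
  fix y assume "y \<in> growth_space N r"
  then obtain D where D: "\<And>j. norm ((N ^^ j) y) \<le> D * r ^ j"
    by (auto simp: growth_space_def)
  show "x + y \<in> growth_space N r"
    by (rule growth_spaceI[where C = "C + D"])
       (simp add: linear_add[OF lin] distrib_right norm_triangle_le add_mono[OF C D])
qed

lemma closed_growth_space:
  assumes N: "bounded_linear N" and par: "paranormal N" and r: "r > 0"
  shows "closed (growth_space N r)"
proof -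
  have "continuous_on UNIV (N ^^ j)" for j
    using bounded_linear_funpow[OF N] by (rule linear_continuous_on)
  then show ?thesis
    unfolding growth_space_paranormal[OF assms]
    by (intro closed_Collect_all closed_Collect_le continuous_intros)
qed

section \<open>Normal operators and their growth spaces\<close>

lemma normal_norm_eq:
  assumes "radjoint N N'" and "\<And>x. N (N' x) = N' (N x)"
  shows "norm (N' x) = norm (N x)"
proof -
  have "(norm (N x))\<^sup>2 = (norm (N' x))\<^sup>2"
    unfolding rip_self[symmetric] using assms
    by (metis radjointD radjoint_sym)
  then show ?thesis by (simp add: power2_eq_iff_nonneg)
qed

lemma normal_paranormal:
  assumes "radjoint N N'" and "\<And>x. N (N' x) = N' (N x)"
  shows "paranormal N"
  unfolding paranormal_def
proof
  fix x
  have "(norm (N x))\<^sup>2 = rip (N' (N x)) x"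
    unfolding rip_self[symmetric] by (simp add: radjointD[OF radjoint_sym[OF assms(1)]])
  also have "\<dots> \<le> norm (N' (N x)) * norm x" by (rule rip_le_norm)
  finally show "(norm (N x))\<^sup>2 \<le> norm (N (N x)) * norm x"
    by (simp add: normal_norm_eq[OF assms])
qed

text \<open>Makes the growth space of \<open>N\<close> invariant also under operators that commute
  with \<open>N'\<close>.\<close>

lemma growth_space_adjoint:
  assumes "radjoint N N'" and "\<And>x. N (N' x) = N' (N x)"
  shows "growth_space N' r = growth_space N r"
proof -
  have "norm ((N' ^^ j) x) = norm ((N ^^ j) x)" for j x
    by (rule normal_norm_eq[OF radjoint_funpow[OF assms(1)]])
       (rule funpow_commute[of N N', OF assms(2)])
  then show ?thesis by (simp add: growth_space_def)
qed

text \<open>\<open>positive_lower_bound\<close> applied to \<open>A = N' N / a^2\<close>: a bounded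
  orbit of \<open>z\<close> under \<open>A\<close> bounds \<open>rip ((A ^^ j) z) z\<close>, which
  is the square of \<open>norm ((N ^^ j) z) / a ^ j\<close>, so \<open>z\<close> lies in the growth
  space.\<close>

lemma normal_lower_bound:
  assumes N: "bounded_linear N" and adj: "radjoint N N'"
    and norm: "\<And>x. N (N' x) = N' (N x)" and a: "a > 0"
    and orth: "\<And>z. z \<in> growth_space N a \<Longrightarrow> rip x z = 0"
  shows "a * norm x \<le> norm (N x)"
proof -
  have N': "bounded_linear N'" by (rule radjoint_bounded_linear[OF N adj])
  define A where "A = (\<lambda>z. (1 / a\<^sup>2) *\<^sub>R N' (N z))"
  have blA: "bounded_linear A"
    unfolding A_def
    by (rule bounded_linear_scaleR_right[THEN bounded_linear_compose]) (rule bounded_linear_compose[OF N' N])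
  have sw: "rip (N' x) y = rip x (N y)" for x y
    by (rule radjointD[OF radjoint_sym[OF adj]])
  have ripA: "rip (A x) y = (1 / a\<^sup>2) * rip (N x) (N y)" for x y
    by (simp add: A_def rip.scaleR_left sw)
  have sym: "radjoint A A"
    unfolding radjoint_def
  proof (intro allI)
    fix x y
    show "rip (A x) y = rip x (A y)"
      using ripA[of x y] ripA[of y x] rip_commute[of x "A y"] rip_commute[of "N x" "N y"] by simp
  qed
  have "(norm x)\<^sup>2 \<le> rip (A x) x"
  proof (rule positive_lower_bound[OF blA sym])
    show "rip (A z) z \<ge> 0" for z by (simp add: ripA rip_self)
    fix z C assume C: "\<And>j. norm ((A ^^ j) z) \<le> C"
    have "C \<ge> 0" using C[of 0] norm_ge_zero order_trans by blast
    have pw: "(A ^^ j) z = (1 / a\<^sup>2) ^ j *\<^sub>R (N' ^^ j) ((N ^^ j) z)" for j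
    proof (induction j)
      case (Suc j)
      have "N ((N' ^^ j) y) = (N' ^^ j) (N y)" for y
        using funpow_commute[of N N' 1 j y, OF norm] by simp
      moreover have "(A ^^ Suc j) z = (1 / a\<^sup>2) ^ Suc j *\<^sub>R N' (N ((N' ^^ j) ((N ^^ j) z)))"
        unfolding funpow.simps comp_apply Suc
        by (simp add: A_def linear_scale[OF bounded_linear.linear[OF N]]
            linear_scale[OF bounded_linear.linear[OF N']])
      ultimately show ?case by simp
    qed simp
    have "norm ((N ^^ j) z) \<le> sqrt (C * norm z) * a ^ j" for j
    proof -
      have "(1 / a\<^sup>2) ^ j * (norm ((N ^^ j) z))\<^sup>2 = rip ((A ^^ j) z) z"
        by (simp add: pw rip.scaleR_left rip_self
            radjointD[OF radjoint_funpow[OF radjoint_sym[OF adj]]])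
      also have "\<dots> \<le> norm ((A ^^ j) z) * norm z" by (rule rip_le_norm)
      also have "\<dots> \<le> C * norm z" by (intro mult_right_mono C) simp
      finally have "(norm ((N ^^ j) z))\<^sup>2 \<le> C * norm z * (a\<^sup>2) ^ j"
        using a by (simp add: power_one_over field_simps)
      also have "\<dots> = (sqrt (C * norm z) * a ^ j)\<^sup>2"
        using \<open>C \<ge> 0\<close> by (simp add: power_mult_distrib power_mult[symmetric] mult.commute)
      finally show ?thesis
        by (rule power2_le_imp_le) (use \<open>C \<ge> 0\<close> a in simp)
    qed
    then show "rip x z = 0" by (intro orth growth_spaceI)
  qed
  then have "(a * norm x)\<^sup>2 \<le> (norm (N x))\<^sup>2"
    using a by (simp add: ripA rip_self power_mult_distrib field_simps)
  then show ?thesis by (rule power2_le_imp_le) simp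
qed

section \<open>Paranormal roots of normal operators\<close>

locale paranormal_root_of_normal =
  fixes T S :: "'a::complex_hilbert \<Rightarrow> 'a" and n :: nat
  assumes bounded_T: "bounded_linear T"
    and adj: "radjoint T S"
    and paranormal_T: "paranormal T"
    and n_ge_1: "n \<ge> 1"
    and normal_power: "(T ^^ n) ((S ^^ n) x) = (S ^^ n) ((T ^^ n) x)"
begin

text \<open>The exponent \<open>n\<close> makes \<open>\<rho>\<close> the growth rate per
  application of \<open>T\<close> instead of \<open>T ^^ n\<close>.\<close>

abbreviation E :: "real \<Rightarrow> 'a set" where
  "E \<rho> \<equiv> growth_space (T ^^ n) (\<rho> ^ n)"

lemma bounded_S: "bounded_linear S"
  by (rule radjoint_bounded_linear[OF bounded_T adj])

lemmas adj_power = radjoint_funpow[OF adj, of n]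

lemmas bounded_power = bounded_linear_funpow[OF bounded_T, of n]

lemmas paranormal_power = normal_paranormal[OF adj_power normal_power]

lemma E_adjoint: "growth_space (S ^^ n) r = growth_space (T ^^ n) r"
  by (rule growth_space_adjoint[OF adj_power normal_power])

lemma T_in_E: "x \<in> E \<rho> \<Longrightarrow> T x \<in> E \<rho>"
  by (rule growth_space_commuting[OF bounded_T]) (simp_all add: funpow_swap1)

lemma S_in_E: "x \<in> E \<rho> \<Longrightarrow> S x \<in> E \<rho>"
  unfolding E_adjoint[symmetric]
  by (rule growth_space_commuting[OF bounded_S]) (simp_all add: funpow_swap1)

text \<open>Growth along multiples of \<open>n\<close> controls all iterates: the remainder modulo
  \<open>n\<close> costs only a bounded factor.\<close>

lemma T_upper:
  assumes \<rho>: "\<rho> > 0" and x: "x \<in> E \<rho>"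
  shows "norm (T x) \<le> \<rho> * norm x"
proof (rule paranormal_growth_step[OF paranormal_T \<rho>])
  obtain K where K: "K > 0" "\<And>x. norm (T x) \<le> norm x * K"
    using bounded_linear.pos_bounded[OF bounded_T] by blast
  obtain C where C: "\<And>q. norm (((T ^^ n) ^^ q) x) \<le> C * (\<rho> ^ n) ^ q"
    using x by (auto simp: growth_space_def)
  have C0: "C \<ge> 0" using order_trans[OF norm_ge_zero C[of 0]] by simp
  \<comment> \<open>\<open>L * \<rho>\<close> bounds the norm of \<open>T\<close>, and
    \<open>L \<ge> 1\<close> lets \<open>L ^ s\<close> be replaced by \<open>L ^ n\<close>.\<close>
  define L where "L = max 1 (K / \<rho>)"
  have L: "L \<ge> 1" "K \<le> L * \<rho>"
    using \<rho> by (auto simp: L_def max_def field_simps)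
  have pow: "norm ((T ^^ s) y) \<le> (L * \<rho>) ^ s * norm y" for s y
  proof (induction s)
    case (Suc s)
    have "norm ((T ^^ Suc s) y) \<le> norm ((T ^^ s) y) * K" using K by simp
    also have "\<dots> \<le> ((L * \<rho>) ^ s * norm y) * (L * \<rho>)"
      using L K \<rho> by (intro mult_mono Suc) auto
    finally show ?case by (simp add: mult_ac)
  qed simp
  show "x \<in> growth_space T \<rho>"
  proof (rule growth_spaceI)
    fix j
    define q s where "q = j div n" and "s = j mod n"
    have j: "j = s + n * q" by (simp add: q_def s_def)
    have "s \<le> n" using n_ge_1 by (simp add: s_def less_imp_le)
    have "norm ((T ^^ j) x) = norm ((T ^^ s) (((T ^^ n) ^^ q) x))"
      by (simp add: j funpow_add funpow_mult mult.commute)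
    also have "\<dots> \<le> (L * \<rho>) ^ s * norm (((T ^^ n) ^^ q) x)" by (rule pow)
    also have "\<dots> \<le> (L * \<rho>) ^ s * (C * (\<rho> ^ n) ^ q)"
      using L \<rho> by (intro mult_left_mono C) auto
    also have "\<dots> = L ^ s * (C * \<rho> ^ j)"
      by (simp add: j power_add power_mult power_mult_distrib mult_ac)
    also have "\<dots> \<le> L ^ n * (C * \<rho> ^ j)"
      using L \<rho> C0 \<open>s \<le> n\<close> by (intro mult_right_mono power_increasing) auto
    finally show "norm ((T ^^ j) x) \<le> (L ^ n * C) * \<rho> ^ j" by (simp add: mult_ac)
  qed
qed

text \<open>\<open>S\<close> need not be paranormal; its bound comes from that of \<open>T\<close>
  at \<open>S x\<close>, which stays in the same space.\<close>

lemma S_upper: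
  assumes \<rho>: "\<rho> > 0" and x: "x \<in> E \<rho>"
  shows "norm (S x) \<le> \<rho> * norm x"
proof (cases "S x = 0")
  case False
  have "norm (S x) * norm (S x) = rip (T (S x)) x"
    using radjointD[OF adj, of "S x" x] rip_self[of "S x"] by (simp add: power2_eq_square)
  also have "\<dots> \<le> norm (T (S x)) * norm x" by (rule rip_le_norm)
  also have "\<dots> \<le> \<rho> * norm (S x) * norm x"
    by (intro mult_right_mono T_upper[OF \<rho> S_in_E[OF x]]) simp
  finally have "norm (S x) * norm (S x) \<le> norm (S x) * (\<rho> * norm x)"
    by (simp add: mult_ac)
  then show ?thesis using False by simp
qed (use \<rho> in simp)

text \<open>The lower bound comes from
  \<open>(\<theta> * \<rho>) ^ n * norm v \<le> norm ((X ^^ n) v)\<close> by estimating all but the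
  first application of \<open>X\<close> by \<open>\<rho>\<close>. Normality gives
  \<open>T ^^ n\<close> and \<open>S ^^ n\<close> equal norms, so one argument serves both
  operators.\<close>

lemma slice_norm:
  assumes X: "X = T \<or> X = S" and \<rho>: "\<rho> > 0" and \<theta>: "0 < \<theta>" "\<theta> \<le> 1"
    and v: "v \<in> E \<rho>" and orth: "\<And>z. z \<in> E (\<theta> * \<rho>) \<Longrightarrow> rip v z = 0"
  shows "(norm (X v))\<^sup>2 \<le> \<rho>\<^sup>2 * (norm v)\<^sup>2"
    and "(\<theta> ^ n)\<^sup>2 * \<rho>\<^sup>2 * (norm v)\<^sup>2 \<le> (norm (X v))\<^sup>2"
proof -
  have up: "norm (X y) \<le> \<rho> * norm y" "X y \<in> E \<rho>" if "y \<in> E \<rho>" for y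
    using X T_upper[OF \<rho> that] S_upper[OF \<rho> that] T_in_E[OF that] S_in_E[OF that] by auto
  have "norm (X v) \<le> \<rho> * norm v" using up v by blast
  then show "(norm (X v))\<^sup>2 \<le> \<rho>\<^sup>2 * (norm v)\<^sup>2"
    unfolding power_mult_distrib[symmetric] by (intro power_mono) auto
  have pow: "norm ((X ^^ j) y) \<le> \<rho> ^ j * norm y" if "y \<in> E \<rho>" for j y
    using that
  proof (induction j arbitrary: y)
    case (Suc j)
    have "norm ((X ^^ Suc j) y) = norm ((X ^^ j) (X y))" by (simp add: funpow_swap1)
    also have "\<dots> \<le> \<rho> ^ j * norm (X y)" by (intro Suc.IH up Suc.prems)
    also have "\<dots> \<le> \<rho> ^ j * (\<rho> * norm y)"
      using \<rho> by (intro mult_left_mono up Suc.prems) auto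
    finally show ?case by (simp add: mult_ac)
  qed simp
  obtain m where m: "n = Suc m" using n_ge_1 by (cases n) auto
  have "(\<theta> * \<rho>) ^ n * norm v \<le> norm ((T ^^ n) v)"
    using \<theta> \<rho> by (intro normal_lower_bound[OF bounded_power adj_power normal_power] orth) auto
  also have "\<dots> = norm ((X ^^ n) v)"
    using X normal_norm_eq[OF adj_power normal_power] by auto
  also have "\<dots> = norm ((X ^^ m) (X v))" by (simp add: m funpow_swap1)
  also have "\<dots> \<le> \<rho> ^ m * norm (X v)" by (rule pow[OF up(2)[OF v]])
  finally have "\<rho> ^ m * (\<theta> ^ n * \<rho> * norm v) \<le> \<rho> ^ m * norm (X v)"
    by (simp add: m power_mult_distrib mult_ac)
  then have "\<theta> ^ n * \<rho> * norm v \<le> norm (X v)"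
    using \<rho> by simp
  then have "(\<theta> ^ n * \<rho> * norm v)\<^sup>2 \<le> (norm (X v))\<^sup>2"
    using \<theta> \<rho> by (intro power_mono) auto
  then show "(\<theta> ^ n)\<^sup>2 * \<rho>\<^sup>2 * (norm v)\<^sup>2 \<le> (norm (X v))\<^sup>2"
    by (simp add: power_mult_distrib)
qed

text \<open>Splits \<open>x\<close> into its projection \<open>u\<close> on the inner space and a
  slice part \<open>v\<close>. Their images are orthogonal under both operators, so the defects add;
  on \<open>v\<close> the defect is at most the width of the interval from
  \<open>slice_norm\<close>.\<close>

lemma slice_step:
  assumes \<rho>: "0 < \<rho>" and \<theta>: "0 < \<theta>" "\<theta> \<le> 1"
    and \<kappa>: "\<rho>\<^sup>2 * (1 - (\<theta> ^ n)\<^sup>2) \<le> \<kappa>"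
    and IH: "\<And>u. u \<in> E (\<theta> * \<rho>) \<Longrightarrow> \<bar>(norm (T u))\<^sup>2 - (norm (S u))\<^sup>2\<bar> \<le> \<kappa> * (norm u)\<^sup>2"
    and x: "x \<in> E \<rho>"
  shows "\<bar>(norm (T x))\<^sup>2 - (norm (S x))\<^sup>2\<bar> \<le> \<kappa> * (norm x)\<^sup>2"
proof -
  have pos: "(\<theta> * \<rho>) ^ n > 0" "\<rho> ^ n > 0" using \<rho> \<theta> by simp_all
  note sub = subspace_growth_space[OF bounded_power pos(2)]
  obtain u where u: "u \<in> E (\<theta> * \<rho>)" and orth: "\<And>z. z \<in> E (\<theta> * \<rho>) \<Longrightarrow> rip (x - u) z = 0"
    using orthogonal_projection_exists[OF closed_growth_space[OF bounded_power paranormal_power pos(1)]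
        subspace_growth_space[OF bounded_power pos(1)]] by blast
  define v where "v = x - u"
  have xuv: "x = u + v" by (simp add: v_def)
  have orthv: "rip v z = 0" if "z \<in> E (\<theta> * \<rho>)" for z
    using orth[OF that] by (simp add: v_def)
  obtain C where C: "\<And>j. norm (((T ^^ n) ^^ j) u) \<le> C * ((\<theta> * \<rho>) ^ n) ^ j"
    using u by (auto simp: growth_space_def)
  have C0: "C \<ge> 0" using order_trans[OF norm_ge_zero C[of 0]] by simp
  have "u \<in> E \<rho>"
  proof (rule growth_spaceI)
    fix j
    have "C * ((\<theta> * \<rho>) ^ n) ^ j \<le> C * (\<rho> ^ n) ^ j"
      using C0 \<rho> \<theta> by (intro mult_left_mono power_mono) (auto simp: mult_left_le_one_le)
    with C[of j] show "norm (((T ^^ n) ^^ j) u) \<le> C * (\<rho> ^ n) ^ j" by linarith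
  qed
  then have v: "v \<in> E \<rho>"
    unfolding v_def by (intro subspace_diff[OF sub] x)
  have pyth: "(norm (X x))\<^sup>2 = (norm (X u))\<^sup>2 + (norm (X v))\<^sup>2"
    if X: "linear X" and o: "rip (X u) (X v) = 0" for X :: "'a \<Rightarrow> 'a"
    unfolding xuv linear_add[OF X] norm_add_sq o by simp
  \<comment> \<open>\<open>S (T u)\<close> stays in the inner space, to which \<open>v\<close> is
    orthogonal.\<close>
  have "rip (T u) (T v) = rip v (S (T u))"
    using radjointD[OF adj, of v "T u"] by (simp add: rip_commute)
  also have "\<dots> = 0" by (intro orthv S_in_E T_in_E u)
  finally have pT: "(norm (T x))\<^sup>2 = (norm (T u))\<^sup>2 + (norm (T v))\<^sup>2"
    by (intro pyth bounded_linear.linear[OF bounded_T])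
  have "rip (S u) (S v) = rip v (T (S u))"
    using radjointD[OF adj, of "S u" v] by (simp add: rip_commute)
  also have "\<dots> = 0" by (intro orthv S_in_E T_in_E u)
  finally have pS: "(norm (S x))\<^sup>2 = (norm (S u))\<^sup>2 + (norm (S v))\<^sup>2"
    by (intro pyth bounded_linear.linear[OF bounded_S])
  have px: "(norm x)\<^sup>2 = (norm u)\<^sup>2 + (norm v)\<^sup>2"
    using pyth[of "\<lambda>x. x"] orthv[OF u] by (simp add: rip_commute[of u v] linear_ident)
  note sT = slice_norm[OF disjI1[OF refl] \<rho> \<theta> v orthv]
  note sS = slice_norm[OF disjI2[OF refl] \<rho> \<theta> v orthv]
  have "\<bar>(norm (T v))\<^sup>2 - (norm (S v))\<^sup>2\<bar> \<le> \<rho>\<^sup>2 * (norm v)\<^sup>2 - (\<theta> ^ n)\<^sup>2 * \<rho>\<^sup>2 * (norm v)\<^sup>2"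
    using sT sS by linarith
  also have "\<dots> = (\<rho>\<^sup>2 * (1 - (\<theta> ^ n)\<^sup>2)) * (norm v)\<^sup>2" by (simp add: algebra_simps)
  also have "\<dots> \<le> \<kappa> * (norm v)\<^sup>2" by (intro mult_right_mono \<kappa>) simp
  finally show ?thesis
    using IH[OF u] unfolding pT pS px distrib_left by linarith
qed

lemma norm_T_eq_norm_S: "norm (T x) = norm (S x)"
proof -
  obtain K where K: "K > 0" "\<And>x. norm (T x) \<le> norm x * K"
    using bounded_linear.pos_bounded[OF bounded_T] by blast
  have "norm ((T ^^ j) x) \<le> norm x * K ^ j" for j
  proof (induction j)
    case (Suc j)
    have "norm ((T ^^ Suc j) x) \<le> norm ((T ^^ j) x) * K" using K by simp
    also have "\<dots> \<le> (norm x * K ^ j) * K" using Suc K by (intro mult_right_mono) auto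
    finally show ?case by (simp add: mult_ac)
  qed simp
  then have xK: "x \<in> E K"
    by (intro growth_spaceI[where C = "norm x"]) (simp add: funpow_mult power_mult[symmetric] mult.commute)
  have bound: "\<bar>(norm (T x))\<^sup>2 - (norm (S x))\<^sup>2\<bar> \<le> \<kappa> * (norm x)\<^sup>2" if \<kappa>: "\<kappa> > 0" for \<kappa>
  proof -
    \<comment> \<open>First \<open>\<theta>\<close> is taken so close to 1 that every slice below
      \<open>K\<close> has defect less than \<open>\<kappa>\<close>.\<close>
    have "((\<lambda>\<theta>. K\<^sup>2 * (1 - (\<theta> ^ n)\<^sup>2)) \<longlongrightarrow> K\<^sup>2 * (1 - (1 ^ n)\<^sup>2)) (at_left (1::real))"
      by (intro tendsto_intros)
    then have "\<forall>\<^sub>F \<theta> in at_left (1::real). K\<^sup>2 * (1 - (\<theta> ^ n)\<^sup>2) < \<kappa>"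
      using \<kappa> by (intro order_tendstoD(2)) auto
    moreover have "\<forall>\<^sub>F \<theta> in at_left (1::real). \<theta> \<in> {0<..<1}"
      by (rule eventually_at_left_real) simp
    ultimately have "\<forall>\<^sub>F \<theta> in at_left (1::real). K\<^sup>2 * (1 - (\<theta> ^ n)\<^sup>2) < \<kappa> \<and> \<theta> \<in> {0<..<1}"
      by (rule eventually_conj)
    then obtain \<theta> where \<theta>: "K\<^sup>2 * (1 - (\<theta> ^ n)\<^sup>2) < \<kappa>" "0 < \<theta>" "\<theta> < 1"
      using eventually_happens[of _ "at_left (1::real)"] by auto
    \<comment> \<open>Then \<open>m\<close> slices are taken, enough for the upper bounds alone to
      suffice on the innermost space.\<close>
    have "(\<lambda>m. (\<theta> ^ m * K)\<^sup>2) \<longlonglongrightarrow> (0 * K)\<^sup>2"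
      using \<theta> by (intro tendsto_intros LIMSEQ_power_zero) auto
    then have "\<forall>\<^sub>F m in sequentially. (\<theta> ^ m * K)\<^sup>2 < \<kappa>"
      using \<kappa> by (intro order_tendstoD(2)) auto
    then obtain m where m: "(\<theta> ^ m * K)\<^sup>2 < \<kappa>"
      using eventually_happens[of _ sequentially] by auto
    have "\<forall>y \<in> E \<rho>. \<bar>(norm (T y))\<^sup>2 - (norm (S y))\<^sup>2\<bar> \<le> \<kappa> * (norm y)\<^sup>2"
      if "0 < \<rho>" "\<rho> \<le> K" "(\<theta> ^ i * \<rho>)\<^sup>2 \<le> \<kappa>" for \<rho> i
      using that
    proof (induction i arbitrary: \<rho>)
      case 0
      show ?case
      proof
        fix y assume y: "y \<in> E \<rho>"
        have "(norm (T y))\<^sup>2 \<le> (\<rho> * norm y)\<^sup>2" "(norm (S y))\<^sup>2 \<le> (\<rho> * norm y)\<^sup>2"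
          using T_upper[OF 0(1) y] S_upper[OF 0(1) y] by (auto intro: power_mono)
        then have "\<bar>(norm (T y))\<^sup>2 - (norm (S y))\<^sup>2\<bar> \<le> \<rho>\<^sup>2 * (norm y)\<^sup>2"
          unfolding power_mult_distrib using zero_le_power2[of "norm (T y)"] zero_le_power2[of "norm (S y)"]
          by linarith
        also have "\<dots> \<le> \<kappa> * (norm y)\<^sup>2" using 0(3) by (intro mult_right_mono) auto
        finally show "\<bar>(norm (T y))\<^sup>2 - (norm (S y))\<^sup>2\<bar> \<le> \<kappa> * (norm y)\<^sup>2" .
      qed
    next
      case (Suc i)
      have "\<rho>\<^sup>2 * (1 - (\<theta> ^ n)\<^sup>2) \<le> K\<^sup>2 * (1 - (\<theta> ^ n)\<^sup>2)"
        using Suc.prems \<theta> by (intro mult_right_mono power_mono) (auto simp: power_le_one)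
      then have \<rho>\<kappa>: "\<rho>\<^sup>2 * (1 - (\<theta> ^ n)\<^sup>2) \<le> \<kappa>" using \<theta>(1) by linarith
      have "\<theta> * \<rho> \<le> 1 * \<rho>" using \<theta> Suc.prems by (intro mult_right_mono) auto
      then have "\<theta> * \<rho> \<le> K" using Suc.prems(2) by linarith
      have IH: "\<forall>y \<in> E (\<theta> * \<rho>). \<bar>(norm (T y))\<^sup>2 - (norm (S y))\<^sup>2\<bar> \<le> \<kappa> * (norm y)\<^sup>2"
        using Suc.prems \<theta> \<open>\<theta> * \<rho> \<le> K\<close> by (intro Suc.IH) (auto simp: mult_ac)
      show ?case
        using slice_step[OF Suc.prems(1) \<theta>(2) less_imp_le[OF \<theta>(3)] \<rho>\<kappa>] IH by blast
    qed
    from this[of K m] show ?thesis using K m xK by auto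
  qed
  have "\<bar>(norm (T x))\<^sup>2 - (norm (S x))\<^sup>2\<bar> \<le> 0"
  proof (rule field_le_epsilon)
    fix e :: real assume e: "e > 0"
    \<comment> \<open>The added 1 covers \<open>x = 0\<close>.\<close>
    have "e / ((norm x)\<^sup>2 + 1) > 0" using e by (intro divide_pos_pos) (auto simp: add_nonneg_pos)
    note bound[OF this]
    also have "e / ((norm x)\<^sup>2 + 1) * (norm x)\<^sup>2 \<le> e"
    proof -
      have "(norm x)\<^sup>2 + 1 > 0" by (simp add: add_nonneg_pos)
      then show ?thesis using e by (simp add: field_simps)
    qed
    finally show "\<bar>(norm (T x))\<^sup>2 - (norm (S x))\<^sup>2\<bar> \<le> 0 + e" by simp
  qed
  then have "(norm (T x))\<^sup>2 = (norm (S x))\<^sup>2" by simp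
  then show ?thesis by (simp add: power2_eq_iff_nonneg)
qed

text \<open>Polarization of the norm equality, then moving one operator across each pairing.\<close>

lemma normal: "T (S x) = S (T x)"
proof -
  interpret T: bounded_linear T by (rule bounded_T)
  interpret S: bounded_linear S by (rule bounded_S)
  have eq: "rip (T x) (T y) = rip (S x) (S y)" for x y
  proof -
    have "(norm (T x + T y))\<^sup>2 = (norm (S x + S y))\<^sup>2"
      using norm_T_eq_norm_S[of "x + y"] by (simp add: T.add S.add)
    then show ?thesis by (simp add: norm_add_sq norm_T_eq_norm_S)
  qed
  have "T (S x) - S (T x) = 0"
  proof (rule rip_eq_zero_all)
    fix y
    show "rip (T (S x) - S (T x)) y = 0"
      using radjointD[OF adj, of "S x" y] radjointD[OF radjoint_sym[OF adj], of "T x" y] eq[of x y]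
      by (simp add: rip.diff_left)
  qed
  then show ?thesis by simp
qed

end

section \<open>Reduction to the paranormal case\<close>

lemma ker_funpow_eq:
  assumes "\<And>z. T (T z) = 0 \<Longrightarrow> T z = 0" and "m \<ge> 1" and "(T ^^ m) v = 0"
  shows "T v = 0"
  using assms(2,3)
proof (induction m)
  case (Suc m)
  show ?case
  proof (cases m)
    case (Suc p)
    then have "(T ^^ m) v = 0" using Suc.prems assms(1) by simp
    then show ?thesis using Suc.IH Suc by simp
  qed (use Suc.prems in simp)
qed simp

lemma subspace_closure:
  fixes V :: "'a::real_normed_vector set"
  assumes V: "subspace V"
  shows "subspace (closure V)"
proof (rule subspaceI)
  show "0 \<in> closure V" using subspace_0[OF V] closure_subset by blast
  fix x assume "x \<in> closure V"
  then obtain f where f: "\<And>j. f j \<in> V" "f \<longlonglongrightarrow> x"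
    unfolding closure_sequential by blast
  show "c *\<^sub>R x \<in> closure V" for c
    unfolding closure_sequential
    by (rule exI[of _ "\<lambda>j. c *\<^sub>R f j"]) (intro conjI allI subspace_scale[OF V] tendsto_intros f)
  fix y assume "y \<in> closure V"
  then obtain g where g: "\<And>j. g j \<in> V" "g \<longlonglongrightarrow> y"
    unfolding closure_sequential by blast
  show "x + y \<in> closure V"
    unfolding closure_sequential
    by (rule exI[of _ "\<lambda>j. f j + g j"]) (intro conjI allI subspace_add[OF V] tendsto_intros f g)
qed

text \<open>The inequality extends by continuity to the closed range of \<open>T ^^ p\<close>. The
  orthogonal part \<open>v\<close> of \<open>x\<close> is killed by \<open>T\<close>, so passing
  from \<open>u\<close> to \<open>x\<close> keeps \<open>T x\<close> and can only enlarge the norm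
  on the right.\<close>

lemma k_quasiparanormal_imp_paranormal:
  assumes T: "bounded_linear T" and adj: "radjoint T S" and qp: "quasiposinormal T S"
    and k: "k \<ge> 1" and kq: "k_quasiparanormal k T" and n: "n \<ge> 1"
    and normal: "\<And>x. (T ^^ n) ((S ^^ n) x) = (S ^^ n) ((T ^^ n) x)"
  shows "paranormal T"
  unfolding paranormal_def
proof
  fix x
  interpret T: bounded_linear T by (rule T)
  \<comment> \<open>A multiple of \<open>n\<close>, for normality of \<open>T ^^ p\<close>, and at
    least \<open>k\<close>, so that its range lies in that of \<open>T ^^ k\<close>.\<close>
  define p where "p = n * k"
  have "k \<le> p" "p \<ge> 1" using n k by (auto simp: p_def)
  have blp: "bounded_linear (T ^^ p)" by (rule bounded_linear_funpow[OF T])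
  let ?K = "closure (range (T ^^ p))"
  have "subspace ?K"
    by (intro subspace_closure linear_subspace_image bounded_linear.linear[OF blp] subspace_UNIV)
  then obtain u where u: "u \<in> ?K" and orth: "\<And>z. z \<in> ?K \<Longrightarrow> rip (x - u) z = 0"
    using orthogonal_projection_exists[OF closed_closure, where x = x] by blast
  define v where "v = x - u"
  have "(S ^^ p) v = 0"
  proof (rule rip_eq_zero_all)
    fix y
    have "rip v ((T ^^ p) y) = 0"
      unfolding v_def by (rule orth) (use closure_subset[of "range (T ^^ p)"] in blast)
    then show "rip ((S ^^ p) v) y = 0"
      by (simp add: radjointD[OF radjoint_funpow[OF radjoint_sym[OF adj]]])
  qed
  moreover have "norm ((S ^^ p) v) = norm ((T ^^ p) v)"
    unfolding p_def funpow_mult[symmetric]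
    by (rule normal_norm_eq[OF radjoint_funpow[OF radjoint_funpow[OF adj]]])
       (rule funpow_commute[of "T ^^ n" "S ^^ n", OF normal])
  ultimately have "(T ^^ p) v = 0" by simp
  \<comment> \<open>\<open>T z\<close> lies in the kernel of \<open>T\<close>, hence in that of
    \<open>S\<close>, so \<open>rip (T z) (T z) = rip z (S (T z))\<close> vanishes.\<close>
  have "T z = 0" if "T (T z) = 0" for z
  proof -
    have "S (T z) = 0" using qp that by (auto simp: quasiposinormal_def ker_def)
    then have "(norm (T z))\<^sup>2 = 0"
      by (simp add: rip_self[symmetric] radjointD[OF adj] rip.zero_right)
    then show ?thesis by simp
  qed
  then have Tv: "T v = 0"
    using ker_funpow_eq[of T p v] \<open>p \<ge> 1\<close> \<open>(T ^^ p) v = 0\<close> by blast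
  have xuv: "x = u + v" by (simp add: v_def)
  have Tx: "T x = T u" by (simp add: xuv T.add Tv)
  have "closed {y. (norm (T y))\<^sup>2 \<le> norm (T (T y)) * norm y}"
    by (intro closed_Collect_le continuous_intros T.continuous_on)
  moreover have "range (T ^^ p) \<subseteq> {y. (norm (T y))\<^sup>2 \<le> norm (T (T y)) * norm y}"
  proof safe
    fix y
    have "(T ^^ p) y = (T ^^ k) ((T ^^ (p - k)) y)"
      using funpow_add[of k "p - k" T] \<open>k \<le> p\<close> by simp
    then show "(norm (T ((T ^^ p) y)))\<^sup>2 \<le> norm (T (T ((T ^^ p) y))) * norm ((T ^^ p) y)"
      using kq by (simp add: k_quasiparanormal_def numeral_2_eq_2)
  qed
  ultimately have "?K \<subseteq> {y. (norm (T y))\<^sup>2 \<le> norm (T (T y)) * norm y}"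
    by (rule closure_minimal[rotated])
  then have "(norm (T u))\<^sup>2 \<le> norm (T (T u)) * norm u" using u by blast
  also have "norm u \<le> norm x"
  proof (rule power2_le_imp_le)
    show "(norm u)\<^sup>2 \<le> (norm x)\<^sup>2"
      unfolding xuv norm_add_sq using orth[OF u] rip_commute[of u v] by (simp add: v_def)
  qed simp
  then have "norm (T (T u)) * norm u \<le> norm (T (T u)) * norm x"
    by (rule mult_left_mono) simp
  finally show "(norm (T x))\<^sup>2 \<le> norm (T (T x)) * norm x" by (simp add: Tx)
qed

theorem theorem6p5:
  fixes T S :: "'a::complex_hilbert \<Rightarrow> 'a" and k n :: nat
  assumes "bounded_clinear T"
    and "is_adjoint T S"
    and "quasiposinormal T S"
    and "k \<ge> 1" and "k_quasiparanormal k T"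
    and "n \<ge> 1" and "normal_op (T ^^ n) (S ^^ n)"
  shows "normal_op T S"
proof -
  have T: "bounded_linear T" using assms(1) by (simp add: bounded_clinear_def)
  have adj: "radjoint T S" using assms(2) by (simp add: is_adjoint_def radjoint_def rip_def)
  have normal: "(T ^^ n) ((S ^^ n) x) = (S ^^ n) ((T ^^ n) x)" for x
    using assms(7) by (simp add: normal_op_def fun_eq_iff)
  interpret paranormal_root_of_normal T S n
    by (rule paranormal_root_of_normal.intro)
      (fact T adj \<open>n \<ge> 1\<close> normal k_quasiparanormal_imp_paranormal[OF T adj assms(3-6) normal])+
  show ?thesis by (simp add: normal_op_def fun_eq_iff local.normal)
qed

end
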